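(* For any integer $n\ge 3$, the alternating group $A_n$ admits a uniform cyclic group factorization with multiplicity $1$; that is, there exist $k\ge 1$ and cyclic subgroups $H_1,\ldots,H_k$ of $A_n$ such that every $g\in A_n$ can be written as $g=h_1h_2\cdots h_k$ with $h_i\in H_i$ ($1\le i\le k$) in exactly one way.
   Context: Let $G$ be a finite group and $\mathcal{H}=(H_1,H_2,\ldots,H_k)$, $k\ge 1$, an ordered tuple of cyclic subgroups of $G$. Then $\mathcal{H}$ is a uniform cyclic group factorization of $G$ with multiplicity $t$ ($t\ge 1$) if for every $g\in G$ the number of tuples $(h_1,\ldots,h_k)\in H_1\times\cdots\times H_k$ with $h_1h_2\cdots h_k=g$ equals $t$. *)

theory Defs
  imports "HOL-Algebra.Algebra"
begin

(* The tuple (H_1, ..., H_k) is a list of subsets of the carrier. listset Hs is the Cartesian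
   product H_1 x ... x H_k, as lists; the closing unit of the foldr is harmless because
   h_1 ... h_k 1 = h_1 ... h_k. *)
definition uniform_cyclic_factorization ::
    "('a, 'b) monoid_scheme \<Rightarrow> 'a set list \<Rightarrow> nat \<Rightarrow> bool"
  where "uniform_cyclic_factorization G Hs t \<longleftrightarrow>
    group G \<and> finite (carrier G) \<and>
    length Hs \<ge> 1 \<and> t \<ge> 1 \<and>
    (\<forall>H \<in> set Hs. subgroup H G \<and> cyclic_group (G\<lparr>carrier := H\<rparr>)) \<and>
    (\<forall>g \<in> carrier G.
       card {hs \<in> listset Hs. foldr (\<otimes>\<^bsub>G\<^esub>) hs \<one>\<^bsub>G\<^esub> = g} = t)"

end

theory Submission
  imports Defs "HOL-Number_Theory.Cong"
begin

text \<open>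
  The proof is by induction on \<open>n\<close>, starting from the trivial group \<open>A\<^sub>2\<close>. Let \<open>n \<ge> 3\<close> and regard
  \<open>A\<^bsub>n-1\<^esub>\<close> as the stabilizer of the point \<open>n\<close> in \<open>A\<^sub>n\<close>. If \<open>T\<^sub>1, \<dots>, T\<^sub>r\<close> are cyclic subgroups of
  \<open>A\<^sub>n\<close> such that every point of \<open>{1..n}\<close> is \<open>(t\<^sub>1 \<circ> \<dots> \<circ> t\<^sub>r) n\<close> for exactly one tuple with
  \<open>t\<^sub>i \<in> T\<^sub>i\<close>, then these products form a transversal for the left cosets of the stabilizer, and
  putting \<open>T\<^sub>1, \<dots>, T\<^sub>r\<close> in front of a factorization of \<open>A\<^bsub>n-1\<^esub>\<close> gives one of \<open>A\<^sub>n\<close>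
  (lemma \<open>factorization_extend\<close>).

  Let \<open>\<sigma>\<close> be the \<open>n\<close>-cycle \<open>(1 2 \<dots> n)\<close>. If \<open>n\<close> is odd, then \<open>\<sigma>\<close> is an even permutation, and the
  single group generated by \<open>\<sigma>\<close> is such a transversal (lemma \<open>transversal_odd\<close>). If \<open>n\<close> is even,
  \<open>\<sigma>\<close> is odd, but \<open>\<sigma>\<^sup>2\<close> is even and its two orbits are the odd and the even points; the double
  transposition \<open>\<tau> = (n 1)(2 3)\<close> takes \<open>n\<close> from one orbit to the other, so the groups generated by
  \<open>\<sigma>\<^sup>2\<close> and \<open>\<tau>\<close> form a transversal (lemma \<open>transversal_even\<close>).
\<close>

section \<open>Cyclic subgroups of the alternating group\<close>

text \<open>The set of powers of \<open>p\<close> with exponent in the natural numbers; for a permutation of finite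
  order this is the cyclic group that \<open>p\<close> generates.\<close>

definition powers :: "('a \<Rightarrow> 'a) \<Rightarrow> ('a \<Rightarrow> 'a) set"
  where "powers p = range (\<lambda>k::nat. p ^^ k)"

lemma finite_alt_group: "finite (carrier (alt_group n))"
  by (rule finite_subset[OF _ finite_permutations[of "{1..n}"]]) (auto simp: alt_group_carrier)

lemma alt_group_pow: "p [^]\<^bsub>alt_group n\<^esub> (k::nat) = p ^^ k"
  by (induction k)
    (simp_all add: alt_group_one alt_group_mult nat_pow_def funpow_swap1 fun_eq_iff)

lemma cyclic_subgroup_powers:
  assumes p: "p \<in> carrier (alt_group n)"
  shows "subgroup (powers p) (alt_group n) \<and>
    cyclic_group ((alt_group n)\<lparr>carrier := powers p\<rparr>)"
proof -
  interpret group "alt_group n" by (rule alt_group_is_group)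
  have gen: "generate (alt_group n) {p} = powers p"
    using generate_pow_on_finite_carrier[OF finite_alt_group p]
    by (auto simp: powers_def alt_group_pow)
  have "subgroup_generated (alt_group n) {p} = (alt_group n)\<lparr>carrier := powers p\<rparr>"
    using p gen by (simp add: subgroup_generated_def)
  then show ?thesis
    using cyclic_group_generated[of p] generate_is_subgroup[of "{p}"] p gen by auto
qed

section \<open>Extending a factorization of a point stabilizer\<close>

lemma listset_append:
  "listset (As @ Bs) = {xs @ ys |xs ys. xs \<in> listset As \<and> ys \<in> listset Bs}"
proof (induction As)
  case (Cons A As)
  show ?case (is "?L = ?R")
  proof (intro subset_antisym subsetI)
    fix zs assume "zs \<in> ?L"
    then obtain x xs ys where "zs = (x # xs) @ ys" "x \<in> A" "xs \<in> listset As" "ys \<in> listset Bs"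
      unfolding append_Cons listset.simps set_Cons_def Cons.IH by blast
    moreover from this have "x # xs \<in> listset (A # As)" by (simp add: set_Cons_def)
    ultimately show "zs \<in> ?R" by blast
  next
    fix zs assume "zs \<in> ?R"
    then obtain x xs ys where "zs = x # (xs @ ys)" "x \<in> A" "xs \<in> listset As" "ys \<in> listset Bs"
      by (auto simp: set_Cons_def)
    then show "zs \<in> ?L"
      unfolding append_Cons listset.simps set_Cons_def Cons.IH by blast
  qed
qed auto

lemma foldr_comp_append:
  "foldr (\<circ>) (xs @ ys) id = foldr (\<circ>) xs id \<circ> foldr (\<circ>) ys id"
  by (induction xs) (simp_all add: comp_assoc)

lemma foldr_comp_closed:
  assumes "\<forall>A \<in> set As. A \<subseteq> carrier (alt_group n)" "xs \<in> listset As"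
  shows "foldr (\<circ>) xs id \<in> carrier (alt_group n)"
  using assms
proof (induction As arbitrary: xs)
  case Nil
  then have "foldr (\<circ>) xs id = id" by simp
  then show ?case by (simp only: alt_group_carrier permutes_id evenperm_id)
next
  case (Cons A As)
  then obtain x ys where xs: "xs = x # ys" "x \<in> A" "ys \<in> listset As"
    by (auto simp: set_Cons_def)
  then have "x \<in> carrier (alt_group n)" "foldr (\<circ>) ys id \<in> carrier (alt_group n)"
    using Cons.prems(1) Cons.IH[of ys] by (simp_all only: list.set insert_iff) blast+
  then have "x \<circ> foldr (\<circ>) ys id \<in> carrier (alt_group n)"
    using monoid.m_closed[OF group.is_monoid[OF alt_group_is_group], of x n "foldr (\<circ>) ys id"]
    by (simp only: alt_group_mult)
  then show ?case unfolding xs(1) foldr.simps comp_apply .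
qed

lemma uniform_cyclic_factorization_alt_iff:
  "uniform_cyclic_factorization (alt_group n) Hs 1 \<longleftrightarrow>
    Hs \<noteq> [] \<and>
    (\<forall>H \<in> set Hs. subgroup H (alt_group n) \<and> cyclic_group ((alt_group n)\<lparr>carrier := H\<rparr>)) \<and>
    (\<forall>g \<in> carrier (alt_group n). \<exists>!hs. hs \<in> listset Hs \<and> foldr (\<circ>) hs id = g)"
proof -
  have ex1: "card {x. P x} = 1 \<longleftrightarrow> (\<exists>!x. P x)" for P :: "(nat \<Rightarrow> nat) list \<Rightarrow> bool"
  proof -
    have "(\<forall>y. P y \<longleftrightarrow> y = x) \<longleftrightarrow> P x \<and> (\<forall>y. P y \<longrightarrow> y = x)" for x by auto
    then show ?thesis by (simp add: card_1_singleton_iff set_eq_iff Ex1_def)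
  qed
  have len: "length Hs \<ge> 1 \<longleftrightarrow> Hs \<noteq> []" by (cases Hs) simp_all
  show ?thesis
    unfolding uniform_cyclic_factorization_def alt_group_mult alt_group_one ex1 len
    by (simp only: alt_group_is_group finite_alt_group order_refl simp_thms)
qed

lemma alt_group_mono:
  assumes "m \<le> n" shows "carrier (alt_group m) \<subseteq> carrier (alt_group n)"
proof
  fix p assume "p \<in> carrier (alt_group m)"
  moreover have "{1..m} \<subseteq> {1..n}" using assms by auto
  ultimately show "p \<in> carrier (alt_group n)"
    unfolding alt_group_carrier using permutes_subset by blast
qed

lemma subgroup_alt_group_mono:
  assumes "m \<le> n" "subgroup H (alt_group m)"
  shows "subgroup H (alt_group n)"
proof -
  have "subgroup (carrier (alt_group m)) (alt_group n)"
  proof (rule group.subgroupI[OF alt_group_is_group])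
    fix a b assume a: "a \<in> carrier (alt_group m)" "b \<in> carrier (alt_group m)"
    then show "inv\<^bsub>alt_group n\<^esub> a \<in> carrier (alt_group m)"
      using alt_group_mono[OF assms(1)] by (auto simp: alt_group_inv_equality alt_group_inv_closed)
    show "a \<otimes>\<^bsub>alt_group n\<^esub> b \<in> carrier (alt_group m)"
      using monoid.m_closed[OF group.is_monoid[OF alt_group_is_group] a]
      by (simp add: alt_group_mult)
  next
    show "carrier (alt_group m) \<noteq> {}"
      using group.is_monoid[OF alt_group_is_group, of m] monoid.one_closed by blast
  qed (rule alt_group_mono[OF assms(1)])
  moreover have "(alt_group n)\<lparr>carrier := carrier (alt_group m)\<rparr> = alt_group m"
    by (simp add: alt_group_def sym_group_def)
  ultimately show ?thesis
    using group.incl_subgroup[OF alt_group_is_group] assms(2) by metis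
qed

lemma alt_group_stabilizer:
  assumes g: "g \<in> carrier (alt_group (Suc m))" and g_last: "g (Suc m) = Suc m"
  shows "g \<in> carrier (alt_group m)"
proof -
  have "g permutes {1..m}"
    by (rule permutes_superset[of g "{1..Suc m}"])
      (use assms in \<open>auto simp: alt_group_carrier le_Suc_eq\<close>)
  then show ?thesis using g by (simp add: alt_group_carrier)
qed

lemma factorization_extend:
  assumes Hs: "uniform_cyclic_factorization (alt_group m) Hs 1"
    and Ts: "\<forall>T \<in> set Ts. subgroup T (alt_group (Suc m)) \<and>
      cyclic_group ((alt_group (Suc m))\<lparr>carrier := T\<rparr>)"
    and transversal:
      "\<And>y. y \<in> {1..Suc m} \<Longrightarrow> \<exists>!ts. ts \<in> listset Ts \<and> foldr (\<circ>) ts id (Suc m) = y"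
  shows "uniform_cyclic_factorization (alt_group (Suc m)) (Ts @ Hs) 1"
  unfolding uniform_cyclic_factorization_alt_iff
proof (intro conjI ballI)
  note Hs = Hs[unfolded uniform_cyclic_factorization_alt_iff]
  show "Ts @ Hs \<noteq> []" using Hs by simp
  fix H assume H: "H \<in> set (Ts @ Hs)"
  show "subgroup H (alt_group (Suc m))"
    using H Ts Hs subgroup_alt_group_mono[of m "Suc m" H] by auto
  have "(alt_group (Suc m))\<lparr>carrier := H\<rparr> = (alt_group m)\<lparr>carrier := H\<rparr>"
    by (simp add: alt_group_def sym_group_def)
  then show "cyclic_group ((alt_group (Suc m))\<lparr>carrier := H\<rparr>)"
    using H Ts Hs by auto
next
  note Hs = Hs[unfolded uniform_cyclic_factorization_alt_iff]
  have TsG: "foldr (\<circ>) ts id \<in> carrier (alt_group (Suc m))" if "ts \<in> listset Ts" for ts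
    using foldr_comp_closed[OF _ that] Ts subgroup.subset by blast
  have HsG: "foldr (\<circ>) hs id \<in> carrier (alt_group m)" if "hs \<in> listset Hs" for hs
    using foldr_comp_closed[OF _ that] Hs subgroup.subset by blast
  have fix_last: "h (Suc m) = Suc m" if "h \<in> carrier (alt_group m)" for h
    using that by (auto simp: alt_group_carrier intro: permutes_not_in)
  fix g assume g: "g \<in> carrier (alt_group (Suc m))"
  then have "g (Suc m) \<in> {1..Suc m}"
    by (metis alt_group_carrier atLeastAtMost_iff le_add1 order_refl permutes_in_image plus_1_eq_Suc)
  from transversal[OF this] obtain ts where ts: "ts \<in> listset Ts"
    "foldr (\<circ>) ts id (Suc m) = g (Suc m)"
    and ts_unique: "\<And>ts'. ts' \<in> listset Ts \<Longrightarrow> foldr (\<circ>) ts' id (Suc m) = g (Suc m) \<Longrightarrow> ts' = ts"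
    by blast
  define t where "t = foldr (\<circ>) ts id"
  have t: "t \<in> carrier (alt_group (Suc m))" using TsG[OF ts(1)] by (simp add: t_def)
  then have bij: "bij t" by (auto simp: alt_group_carrier intro: permutes_bij)
  have "inv' t \<circ> g \<in> carrier (alt_group (Suc m))"
    using monoid.m_closed[OF group.is_monoid[OF alt_group_is_group]
        alt_group_inv_closed[OF t] g]
    by (simp add: alt_group_mult)
  moreover have "(inv' t \<circ> g) (Suc m) = Suc m"
    using ts(2) bij by (simp add: t_def[symmetric] bij_is_inj inv_f_eq)
  ultimately have "inv' t \<circ> g \<in> carrier (alt_group m)"
    by (rule alt_group_stabilizer)
  with Hs obtain hs where hs: "hs \<in> listset Hs" "foldr (\<circ>) hs id = inv' t \<circ> g"
    and hs_unique: "\<And>hs'. hs' \<in> listset Hs \<Longrightarrow> foldr (\<circ>) hs' id = inv' t \<circ> g \<Longrightarrow> hs' = hs"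
    by blast
  show "\<exists>!xs. xs \<in> listset (Ts @ Hs) \<and> foldr (\<circ>) xs id = g"
  proof (rule ex1I[of _ "ts @ hs"])
    show "ts @ hs \<in> listset (Ts @ Hs) \<and> foldr (\<circ>) (ts @ hs) id = g"
    proof
      show "ts @ hs \<in> listset (Ts @ Hs)" using ts(1) hs(1) by (auto simp: listset_append)
      have "t \<circ> (inv' t \<circ> g) = g"
        using bij by (simp add: fun_eq_iff bij_is_surj surj_f_inv_f)
      then show "foldr (\<circ>) (ts @ hs) id = g"
        by (simp only: foldr_comp_append hs(2) t_def[symmetric])
    qed
  next
    fix xs assume xs_prod: "xs \<in> listset (Ts @ Hs) \<and> foldr (\<circ>) xs id = g"
    then obtain ts' hs' where xs: "xs = ts' @ hs'" "ts' \<in> listset Ts" "hs' \<in> listset Hs"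
      unfolding listset_append by auto
    have eq: "foldr (\<circ>) ts' id \<circ> foldr (\<circ>) hs' id = g"
      using xs_prod by (simp only: xs(1) foldr_comp_append)
    have "foldr (\<circ>) ts' id (Suc m) = g (Suc m)"
      using fix_last[OF HsG[OF xs(3)]] eq by (metis comp_apply)
    then have ts': "ts' = ts" using ts_unique xs by blast
    then have "t \<circ> foldr (\<circ>) hs' id = g" using eq by (simp only: t_def)
    then have "foldr (\<circ>) hs' id = inv' t \<circ> g"
      using inv_o_cancel[OF bij_is_inj[OF bij]] by (metis comp_assoc id_comp)
    then show "xs = ts @ hs" using hs_unique xs ts' by blast
  qed
qed

section \<open>Transversals of the point stabilizer\<close>

text \<open>The cycle \<open>(1 2 \<dots> n)\<close>.\<close>

definition long_cycle :: "nat \<Rightarrow> nat \<Rightarrow> nat"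
  where "long_cycle n = cycle_of_list [1..<Suc n]"

lemma long_cycle_permutes: "long_cycle n permutes {1..n}"
  using cycle_permutes[of "[1..<Suc n]"]
  by (simp add: long_cycle_def atLeastLessThanSuc_atLeastAtMost del: upt_Suc)

lemma permutation_long_cycle: "permutation (long_cycle n)"
  by (simp add: long_cycle_def permutation_of_cycle)

lemma long_cycle_pow_mod: "long_cycle n ^^ (k mod n) = long_cycle n ^^ k"
proof -
  have "long_cycle n ^^ n = id"
    using cycle_is_id_root[of "[1..<Suc n]"] by (simp add: long_cycle_def del: upt_Suc)
  then show ?thesis by (intro ext funpow_mod_eq) simp
qed

lemma long_cycle_pow:
  assumes "i < n" shows "(long_cycle n ^^ k) (Suc i) = Suc ((i + k) mod n)"
proof -
  have "map (long_cycle n ^^ k) [1..<Suc n] ! i = rotate k [1..<Suc n] ! i"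
    using cyclic_rotation[of "[1..<Suc n]" k] by (simp add: long_cycle_def del: upt_Suc)
  moreover have "[1..<Suc n] ! j = Suc j" if "j < n" for j
    using that by (simp del: upt_Suc)
  ultimately show ?thesis
    using assms by (simp add: nth_rotate add.commute del: upt_Suc)
qed

lemma long_cycle_pow_inject:
  assumes "(long_cycle n ^^ i) n = (long_cycle n ^^ j) n" "n > 0"
  shows "i mod n = j mod n"
proof -
  have "[n - 1 + i = n - 1 + j] (mod n)"
    using assms long_cycle_pow[of "n - 1" n] by (auto simp: cong_def)
  then show ?thesis unfolding cong_add_lcancel_nat by (simp only: cong_def)
qed

lemma long_cycle_pow_transitive:
  assumes "y \<in> {1..n}" shows "(long_cycle n ^^ y) n = y"
proof -
  have "(n - 1 + y) mod n = y - 1"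
    using assms mod_add_self1[of n "y - 1"] by auto
  then show ?thesis using assms long_cycle_pow[of "n - 1" n y] by simp
qed

lemma long_cycle_pow_in_alt_group:
  assumes "even k \<or> odd n"
  shows "long_cycle n ^^ k \<in> carrier (alt_group n)"
proof -
  have sgn: "sign (long_cycle n ^^ j) = sign (long_cycle n) ^ j" for j
  proof (induction j)
    case (Suc j)
    show ?case
      unfolding funpow.simps power_Suc
        sign_compose[OF permutation_long_cycle permutation_funpow[OF permutation_long_cycle]] Suc.IH ..
  qed simp
  \<comment> \<open>For odd \<open>n\<close> the sign is \<open>1\<close>, because its \<open>n\<close>-th power is the sign of the identity.\<close>
  have "sign (long_cycle n) ^ n = 1"
    using sgn[of n] long_cycle_pow_mod[of n n] by simp
  then have "sign (long_cycle n ^^ k) = 1"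
    unfolding sgn using assms by (cases "long_cycle n" rule: sign_cases) auto
  then have "evenperm (long_cycle n ^^ k)" by (simp add: sign_def split: if_splits)
  then show ?thesis
    unfolding alt_group_carrier using permutes_funpow[OF long_cycle_permutes] by blast
qed

lemma transversal_odd:
  assumes "odd n" "y \<in> {1..n}"
  shows "\<exists>!ts. ts \<in> listset [powers (long_cycle n)] \<and> foldr (\<circ>) ts id n = y"
proof (rule ex1I[of _ "[long_cycle n ^^ y]"])
  show "[long_cycle n ^^ y] \<in> listset [powers (long_cycle n)] \<and>
      foldr (\<circ>) [long_cycle n ^^ y] id n = y"
    using long_cycle_pow_transitive[OF assms(2)] by (auto simp: set_Cons_def powers_def)
next
  fix ts assume "ts \<in> listset [powers (long_cycle n)] \<and> foldr (\<circ>) ts id n = y"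
  then obtain k where k: "ts = [long_cycle n ^^ k]" "(long_cycle n ^^ k) n = y"
    by (auto simp: set_Cons_def powers_def)
  then have "k mod n = y mod n"
    using long_cycle_pow_inject[of k n y] long_cycle_pow_transitive[OF assms(2)] assms(2) by auto
  then show "ts = [long_cycle n ^^ y]"
    using k(1) by (metis long_cycle_pow_mod)
qed

text \<open>The permutation \<open>(n 1)(2 3)\<close>, an involution for \<open>n \<ge> 4\<close>. The second transposition only makes it even.\<close>

definition double_swap :: "nat \<Rightarrow> nat \<Rightarrow> nat"
  where "double_swap n = transpose n 1 \<circ> transpose 2 3"

lemma double_swap_alt:
  assumes "n \<ge> 4" shows "double_swap n \<in> carrier (alt_group n)"
  using assms unfolding double_swap_def alt_group_carrier
  by (auto simp: evenperm_comp evenperm_swap permutation_swap_id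
      intro!: permutes_compose permutes_swap_id)

lemma powers_double_swap:
  assumes "n \<ge> 4" shows "powers (double_swap n) = {id, double_swap n}"
proof -
  have "double_swap n \<circ> double_swap n = id"
    using assms by (auto simp: double_swap_def fun_eq_iff transpose_def)
  then have "double_swap n ^^ k \<in> {id, double_swap n}" for k
    by (induction k) auto
  moreover have "id = double_swap n ^^ 0" "double_swap n = double_swap n ^^ 1" by simp_all
  then have "id \<in> powers (double_swap n)" "double_swap n \<in> powers (double_swap n)"
    unfolding powers_def by (blast intro: range_eqI)+
  ultimately show ?thesis by (auto simp: powers_def)
qed

text \<open>On the point \<open>n\<close> the involution acts like the long cycle, so a product of the \<open>k\<close>-th power of
  the squared cycle and the \<open>e\<close>-th power of the involution, \<open>e < 2\<close>, takes \<open>n\<close> where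
  the power \<open>2 * k + e\<close> of the cycle does. As \<open>n\<close> is even, this exponent modulo \<open>n\<close>
  determines \<open>e\<close>, and then \<open>2 * k\<close> modulo \<open>n\<close> and the power of the squared cycle.\<close>

lemma transversal_even:
  assumes "even n" "n \<ge> 4" "y \<in> {1..n}"
  shows "\<exists>!ts. ts \<in> listset [powers (long_cycle n ^^ 2), powers (double_swap n)] \<and>
    foldr (\<circ>) ts id n = y" (is "\<exists>!ts. ts \<in> listset ?Ts \<and> _")
proof -
  let ?\<sigma> = "long_cycle n"
  define f where "f e = (if e = 0 then id else double_swap n)" for e :: nat
  have f: "f e n = (?\<sigma> ^^ e) n" if "e < 2" for e
  proof -
    have "double_swap n n = 1"
      using assms by (auto simp: double_swap_def transpose_def)
    moreover have "(?\<sigma> ^^ 1) n = 1"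
      using long_cycle_pow_transitive[of 1 n] assms by simp
    ultimately show ?thesis using that by (auto simp: f_def less_2_cases_iff)
  qed
  have prod: "foldr (\<circ>) [?\<sigma> ^^ (2 * k), f e] id n = (?\<sigma> ^^ (2 * k + e)) n" if "e < 2" for k e
    using f[OF that] by (simp add: funpow_add)
  have "powers (double_swap n) = f ` {..<2}"
    using powers_double_swap[OF assms(2)] by (auto simp: f_def numeral_2_eq_2 lessThan_Suc)
  then have mem: "ts \<in> listset ?Ts \<longleftrightarrow> (\<exists>k e. e < 2 \<and> ts = [?\<sigma> ^^ (2 * k), f e])" for ts
    by (auto simp: set_Cons_def powers_def funpow_mult mult.commute)
  show ?thesis
  proof (rule ex1I[of _ "[?\<sigma> ^^ (2 * (y div 2)), f (y mod 2)]"])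
    have "foldr (\<circ>) [?\<sigma> ^^ (2 * (y div 2)), f (y mod 2)] id n = y"
      using prod[of "y mod 2" "y div 2"] long_cycle_pow_transitive[OF assms(3)] by simp
    moreover have "y mod 2 < 2" by simp
    ultimately show "[?\<sigma> ^^ (2 * (y div 2)), f (y mod 2)] \<in> listset ?Ts \<and>
        foldr (\<circ>) [?\<sigma> ^^ (2 * (y div 2)), f (y mod 2)] id n = y"
      unfolding mem by blast
  next
    fix ts assume ts: "ts \<in> listset ?Ts \<and> foldr (\<circ>) ts id n = y"
    then obtain k e where ke: "e < 2" "ts = [?\<sigma> ^^ (2 * k), f e]"
      unfolding mem by blast
    then have "(?\<sigma> ^^ (2 * k + e)) n = (?\<sigma> ^^ y) n"
      using ts prod[of e k] long_cycle_pow_transitive[OF assms(3)] by simp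
    then have eq: "(2 * k + e) mod n = y mod n"
      using long_cycle_pow_inject[of "2 * k + e" n y] assms(2) by simp
    then have "(2 * k + e) mod 2 = y mod 2"
      using assms(1) by (metis mod_mod_cancel)
    then have e: "e = y mod 2" using ke(1) by simp
    then have "[2 * k + e = 2 * (y div 2) + e] (mod n)"
      using eq by (simp add: cong_def)
    then have "(2 * k) mod n = (2 * (y div 2)) mod n"
      unfolding cong_add_rcancel_nat by (simp only: cong_def)
    then have "?\<sigma> ^^ (2 * k) = ?\<sigma> ^^ (2 * (y div 2))"
      by (metis long_cycle_pow_mod)
    then show "ts = [?\<sigma> ^^ (2 * (y div 2)), f (y mod 2)]"
      using ke(2) e by simp
  qed
qed

section \<open>The factorization\<close>

lemma alt_group_2: "carrier (alt_group 2) = {id}"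
proof -
  have "{1..2::nat} = {1, 2}" by auto
  then show ?thesis
    by (auto simp: alt_group_carrier permutes_doubleton_iff evenperm_swap)
qed

lemma factorization_alt_group_2: "uniform_cyclic_factorization (alt_group 2) [{id}] 1"
proof -
  have "powers (id :: nat \<Rightarrow> nat) = {id}"
    by (auto simp: powers_def)
  then show ?thesis
    using cyclic_subgroup_powers[of id 2] unfolding uniform_cyclic_factorization_alt_iff
    by (auto simp: alt_group_2 set_Cons_def)
qed

theorem proposition5p2:
  fixes n :: nat
  assumes "n \<ge> 3"
  shows "\<exists>Hs. uniform_cyclic_factorization (alt_group n) Hs 1"
proof -
  have "n \<ge> 2" using assms by simp
  then show ?thesis
  proof (induction n rule: dec_induct)
    case base
    show ?case using factorization_alt_group_2 by blast
  next
    case (step m)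
    then obtain Hs where Hs: "uniform_cyclic_factorization (alt_group m) Hs 1" by blast
    show ?case
    proof (cases "odd (Suc m)")
      case True
      have "long_cycle (Suc m) \<in> carrier (alt_group (Suc m))"
        using long_cycle_pow_in_alt_group[of 1 "Suc m"] True by simp
      then have "\<forall>T \<in> set [powers (long_cycle (Suc m))]. subgroup T (alt_group (Suc m)) \<and>
          cyclic_group ((alt_group (Suc m))\<lparr>carrier := T\<rparr>)"
        using cyclic_subgroup_powers by simp
      from factorization_extend[OF Hs this transversal_odd[OF True]] show ?thesis by blast
    next
      case False
      then have n: "even (Suc m)" "Suc m \<ge> 4"
        using step(1) by (simp, cases "m = 2") auto
      have "\<forall>T \<in> set [powers (long_cycle (Suc m) ^^ 2), powers (double_swap (Suc m))].
          subgroup T (alt_group (Suc m)) \<and> cyclic_group ((alt_group (Suc m))\<lparr>carrier := T\<rparr>)"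
        using cyclic_subgroup_powers long_cycle_pow_in_alt_group[of 2 "Suc m"] double_swap_alt[OF n(2)]
        by simp
      from factorization_extend[OF Hs this transversal_even[OF n]] show ?thesis by blast
    qed
  qed
qed

end
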